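(* Let $L$ be a residuated lattice and $n\geq 1$ an integer. Every $n$-fold positive implicative filter of $L$ is an $n$-fold implicative filter of $L$.
   Context: A residuated lattice is an algebra $(L,\wedge,\vee,\otimes,\rightarrow,0,1)$ such that $(L,\wedge,\vee,0,1)$ is a bounded lattice, $(L,\otimes,1)$ is a commutative monoid, and $x\otimes y\leq z$ iff $x\leq y\rightarrow z$. For $x\in L$, $x^n=x\otimes\cdots\otimes x$ ($n$ factors). A subset $F\subseteq L$ is an $n$-fold positive implicative filter if $1\in F$ and for all $x,y,z\in L$: if $x\rightarrow((y^n\rightarrow z)\rightarrow y)\in F$ and $x\in F$, then $y\in F$. A subset $F\subseteq L$ is an $n$-fold implicative filter if $1\in F$ and for all $x,y,z\in L$: if $x^n\rightarrow(y\rightarrow z)\in F$ and $x^n\rightarrow y\in F$, then $x^n\rightarrow z\in F$. *)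

theory Defs
  imports Main
begin

(* Bottom and top of the lattice are the constants 0 and 1 of the algebra, and * is its
   monoid operation.  The axiom one_eq_top says that the monoid unit is the top element:
   the two library classes come with separate constants for them. *)
class residuated_lattice = bounded_lattice + comm_monoid_mult +
  fixes residuum :: "'a \<Rightarrow> 'a \<Rightarrow> 'a"  (infixr \<open>\<^bold>\<rightarrow>\<close> 60)
  assumes one_eq_top: "1 = top"
    and residuation: "x * y \<le> z \<longleftrightarrow> x \<le> y \<^bold>\<rightarrow> z"

definition n_fold_positive_implicative_filter ::
    "nat \<Rightarrow> 'a::residuated_lattice set \<Rightarrow> bool" where
  "n_fold_positive_implicative_filter n F \<longleftrightarrow>
     1 \<in> F \<and>
     (\<forall>x y z. x \<^bold>\<rightarrow> ((y ^ n \<^bold>\<rightarrow> z) \<^bold>\<rightarrow> y) \<in> F \<longrightarrow> x \<in> F \<longrightarrow> y \<in> F)"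

definition n_fold_implicative_filter ::
    "nat \<Rightarrow> 'a::residuated_lattice set \<Rightarrow> bool" where
  "n_fold_implicative_filter n F \<longleftrightarrow>
     1 \<in> F \<and>
     (\<forall>x y z. x ^ n \<^bold>\<rightarrow> (y \<^bold>\<rightarrow> z) \<in> F \<longrightarrow> x ^ n \<^bold>\<rightarrow> y \<in> F \<longrightarrow> x ^ n \<^bold>\<rightarrow> z \<in> F)"

end

theory Submission
  imports Defs
begin

text \<open>
  An \<open>n\<close>-fold positive implicative filter \<open>F\<close> is closed under products and upward closed, so the
  two premises give \<open>x\<^sup>2\<^sup>n \<rightarrow> z \<in> F\<close>. The exponent is then lowered one step at a time down to \<open>n\<close>:
  if \<open>t = (x\<^sup>n\<^sup>+\<^sup>1 \<rightarrow> z) \<in> F\<close> and \<open>u = (x\<^sup>n \<rightarrow> z)\<close>, then \<open>t x \<le> u\<close>, hence \<open>t\<^sup>n x\<^sup>n \<le> u\<^sup>n\<close> and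
  \<open>t\<^sup>n \<le> (u\<^sup>n \<rightarrow> z) \<rightarrow> u\<close>; as \<open>t\<^sup>n \<in> F\<close>, positive implicativity yields \<open>u \<in> F\<close>.
\<close>

context residuated_lattice
begin

lemma le_one: "x \<le> 1"
  by (simp add: one_eq_top)

lemma mult_residuum_le: "(x \<^bold>\<rightarrow> y) * x \<le> y"
  by (simp add: residuation)

lemma residuum_eq_one_iff: "x \<^bold>\<rightarrow> y = 1 \<longleftrightarrow> x \<le> y"
  using residuation[of 1 x y] le_one[of "x \<^bold>\<rightarrow> y"] by (auto intro: order.antisym)

lemma one_residuum: "1 \<^bold>\<rightarrow> x = x"
proof (rule order.antisym)
  show "1 \<^bold>\<rightarrow> x \<le> x"
    using mult_residuum_le[of 1 x] by simp
  show "x \<le> 1 \<^bold>\<rightarrow> x"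
    using residuation[of x 1 x] by simp
qed

lemma mult_right_mono_residuated: "x * z \<le> y * z" if "x \<le> y"
proof -
  have "y \<le> z \<^bold>\<rightarrow> y * z"
    by (simp flip: residuation)
  with that show ?thesis
    by (simp add: residuation)
qed

lemma mult_mono_residuated: "a * c \<le> b * d" if "a \<le> b" "c \<le> d"
  using mult_right_mono_residuated[OF that(1), of c] mult_right_mono_residuated[OF that(2), of b]
  by (simp add: mult.commute order_trans)

lemma power_mono_residuated: "x ^ n \<le> y ^ n" if "x \<le> y"
  by (induction n) (simp_all add: mult_mono_residuated that)

text \<open>By residuation, \<open>w\<close> lies below either side exactly when
  \<open>w * x * y \<le> z\<close>, so the two sides have the same lower bounds.\<close>

lemma residuum_mult: "x * y \<^bold>\<rightarrow> z = x \<^bold>\<rightarrow> (y \<^bold>\<rightarrow> z)"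
proof -
  have "w \<le> x * y \<^bold>\<rightarrow> z \<longleftrightarrow> w \<le> x \<^bold>\<rightarrow> (y \<^bold>\<rightarrow> z)" for w
    by (simp add: mult.assoc flip: residuation)
  then show ?thesis
    by (meson order.antisym order.refl)
qed

end

context
  fixes n :: nat and F :: "'a::residuated_lattice set"
  assumes F: "n_fold_positive_implicative_filter n F"
begin

lemma positive_implicative_one_mem: "1 \<in> F"
  using F by (simp add: n_fold_positive_implicative_filter_def)

text \<open>The inequality makes the corresponding residuum equal to 1, hence a member of
  \<open>F\<close>.\<close>

lemma positive_implicative_memI: "y \<in> F" if "x \<in> F" "x \<le> (y ^ n \<^bold>\<rightarrow> z) \<^bold>\<rightarrow> y"
proof -
  have "x \<^bold>\<rightarrow> ((y ^ n \<^bold>\<rightarrow> z) \<^bold>\<rightarrow> y) \<in> F"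
    using that(2) positive_implicative_one_mem by (simp add: residuum_eq_one_iff[THEN iffD2])
  with F that(1) show ?thesis
    unfolding n_fold_positive_implicative_filter_def by blast
qed

text \<open>Choosing 1 for \<open>z\<close> in the filter condition collapses
  \<open>(y ^ n \<rightarrow> z) \<rightarrow> y\<close> to \<open>1 \<rightarrow> y\<close>, that
  is, to \<open>y\<close>.\<close>

lemma positive_implicative_modus_ponens: "y \<in> F" if "x \<^bold>\<rightarrow> y \<in> F" "x \<in> F"
proof -
  have "y ^ n \<^bold>\<rightarrow> 1 = 1"
    by (simp add: residuum_eq_one_iff le_one)
  then have "x \<^bold>\<rightarrow> ((y ^ n \<^bold>\<rightarrow> 1) \<^bold>\<rightarrow> y) \<in> F"
    using that(1) by (simp add: one_residuum)
  with F that(2) show ?thesis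
    unfolding n_fold_positive_implicative_filter_def by blast
qed

lemma positive_implicative_upward: "y \<in> F" if "x \<in> F" "x \<le> y"
  using that positive_implicative_modus_ponens positive_implicative_one_mem residuum_eq_one_iff
  by metis

lemma positive_implicative_mult: "x * y \<in> F" if "x \<in> F" "y \<in> F"
proof -
  have "x \<le> y \<^bold>\<rightarrow> x * y"
    by (simp flip: residuation)
  with that show ?thesis
    using positive_implicative_upward positive_implicative_modus_ponens by blast
qed

lemma positive_implicative_power: "x ^ k \<in> F" if "x \<in> F"
  by (induction k) (simp_all add: that positive_implicative_one_mem positive_implicative_mult)

lemma positive_implicative_Suc_power_residuum: "x ^ n \<^bold>\<rightarrow> z \<in> F" if "x ^ Suc n \<^bold>\<rightarrow> z \<in> F"
proof -
  define t u where "t = x ^ Suc n \<^bold>\<rightarrow> z" and "u = x ^ n \<^bold>\<rightarrow> z"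
  have "t * x \<le> u"
    using mult_residuum_le[of "x ^ Suc n" z]
    by (simp add: t_def u_def mult.assoc flip: residuation)
  then have "t ^ n * x ^ n \<le> u ^ n"
    by (metis power_mono_residuated power_mult_distrib)
  then have "(u ^ n \<^bold>\<rightarrow> z) * (t ^ n * x ^ n) \<le> z"
    by (meson mult_mono_residuated mult_residuum_le order.refl order.trans)
  \<comment> \<open>As \<open>u\<close> is itself a residuum with antecedent \<open>x ^ n\<close>,
    residuating twice moves \<open>u ^ n \<rightarrow> z\<close> and \<open>x ^ n\<close> to the
    left.\<close>
  then have "t ^ n \<le> (u ^ n \<^bold>\<rightarrow> z) \<^bold>\<rightarrow> u"
    by (simp add: u_def ac_simps flip: residuation)
  moreover have "t ^ n \<in> F"
    using that by (simp add: t_def positive_implicative_power)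
  ultimately show ?thesis
    unfolding u_def by (rule positive_implicative_memI[rotated])
qed

text \<open>Currying hides the surplus factor \<open>x ^ k\<close> in the conclusion, so the
  one-step lemma applies with \<open>x ^ k \<rightarrow> z\<close> in place of \<open>z\<close>;
  uncurrying leaves exponent \<open>n + k\<close> for the induction hypothesis.\<close>

lemma positive_implicative_add_power_residuum: "x ^ n \<^bold>\<rightarrow> z \<in> F" if "x ^ (n + k) \<^bold>\<rightarrow> z \<in> F"
  using that
proof (induction k)
  case (Suc k)
  have "x ^ Suc n \<^bold>\<rightarrow> (x ^ k \<^bold>\<rightarrow> z) \<in> F"
    using Suc.prems by (simp add: power_add mult.left_commute mult.assoc flip: residuum_mult)
  then have "x ^ n \<^bold>\<rightarrow> (x ^ k \<^bold>\<rightarrow> z) \<in> F"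
    by (rule positive_implicative_Suc_power_residuum)
  then show ?case
    using Suc.IH by (simp add: power_add residuum_mult)
qed simp

end

theorem theorem5p7:
  fixes F :: "'a::residuated_lattice set" and n :: nat
  assumes "n \<ge> 1"
    and "n_fold_positive_implicative_filter n F"
  shows "n_fold_implicative_filter n F"
  unfolding n_fold_implicative_filter_def
proof (intro conjI allI impI)
  note F = assms(2)
  show "1 \<in> F"
    using F by (rule positive_implicative_one_mem)
  fix x y z
  assume yz: "x ^ n \<^bold>\<rightarrow> (y \<^bold>\<rightarrow> z) \<in> F" and y: "x ^ n \<^bold>\<rightarrow> y \<in> F"
  let ?s = "x ^ n \<^bold>\<rightarrow> (y \<^bold>\<rightarrow> z)" and ?t = "x ^ n \<^bold>\<rightarrow> y"
  \<comment> \<open>Each premise consumes its own copy of \<open>x ^ n\<close>, which is why the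
    exponent doubles to \<open>n + n\<close>.\<close>
  have "(?s * x ^ n) * (?t * x ^ n) \<le> (y \<^bold>\<rightarrow> z) * y"
    by (intro mult_mono_residuated mult_residuum_le)
  also have "\<dots> \<le> z"
    by (rule mult_residuum_le)
  finally have "?s * ?t \<le> x ^ (n + n) \<^bold>\<rightarrow> z"
    by (simp add: power_add ac_simps flip: residuation)
  then have "x ^ (n + n) \<^bold>\<rightarrow> z \<in> F"
    using positive_implicative_upward[OF F] positive_implicative_mult[OF F yz y] by blast
  then show "x ^ n \<^bold>\<rightarrow> z \<in> F"
    by (rule positive_implicative_add_power_residuum[OF F])
qed

end
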